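(* Let $A=(A_1,\dots,A_m)$ be a tuple of real symmetric $n\times n$ matrices and let $B$ be a real symmetric positive semidefinite $n\times n$ matrix. Then $$W(A,B)\text{ is convex}\;\Rightarrow\;V_{A,B}\text{ is convex}\;\Rightarrow\;W(A)\text{ is convex}.$$ The converse implications do not hold in general: there exist $m,n$, a tuple $A=(A_1,\dots,A_m)$ of real symmetric $n\times n$ matrices and a real symmetric positive semidefinite $n\times n$ matrix $B$ such that $V_{A,B}$ is convex but $W(A,B)$ is not convex, and there exist $m,n$, a tuple $A=(A_1,\dots,A_m)$ of real symmetric $n\times n$ matrices and a real symmetric positive semidefinite $n\times n$ matrix $B$ such that $W(A)$ is convex but $V_{A,B}$ is not convex.
   Context: For a tuple $A=(A_1,\dots,A_m)$ of real symmetric $n\times n$ matrices, the joint numerical range is $W(A)=\{(x^\top A_1x,\dots,x^\top A_mx)\mid x\in\mathbb{R}^n\}\subseteq\mathbb{R}^m$. For symmetric positive semidefinite $B$, $W(A,B)=\{(x^\top A_1x,\dots,x^\top A_mx,x^\top Bx)\mid x\in\mathbb{R}^n\}\subseteq\mathbb{R}^{m+1}$. The lower envelope $V_{A,B}:\mathbb{R}^m\to\mathbb{R}\cup\{+\infty\}$ is $$V_{A,B}(a)=\inf\bigl\{x^\top Bx\;\big|\;x\in\mathbb{R}^n,\ (x^\top A_1x,\dots,x^\top A_mx)=a\bigr\},\qquad\inf\varnothing=+\infty.$$ Convexity of $V_{A,B}$ is meant in the extended-real-valued sense. *)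

theory Defs
  imports "Jordan_Normal_Form.Matrix" "HOL-Library.Extended_Real"
begin

text \<open>
  The dimensions are existentially quantified in part of the statement, so vectors and matrices
  are those of the carrier-based library, and a tuple of matrices is a list.
\<close>

definition sym_mats :: "nat \<Rightarrow> real mat set" where
  "sym_mats n = {M \<in> carrier_mat n n. transpose_mat M = M}"

definition psd_mats :: "nat \<Rightarrow> real mat set" where
  "psd_mats n = {M \<in> sym_mats n. \<forall>x \<in> carrier_vec n. 0 \<le> x \<bullet> (M *\<^sub>v x)}"

definition quad_form :: "real mat \<Rightarrow> real vec \<Rightarrow> real" where
  "quad_form M x = x \<bullet> (M *\<^sub>v x)"

definition quad_map :: "real mat list \<Rightarrow> real vec \<Rightarrow> real vec" where
  "quad_map A x = vec_of_list (map (\<lambda>M. quad_form M x) A)"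

text \<open>
  \<open>W(A)\<close> for an arbitrary tuple; \<open>W(A, B)\<close> is the joint numerical range of the extended
  tuple \<open>A @ [B]\<close>. The size \<open>n\<close> is an argument since \<open>A\<close> may be empty.
\<close>

definition joint_numerical_range :: "nat \<Rightarrow> real mat list \<Rightarrow> real vec set" where
  "joint_numerical_range n A = {quad_map A x | x. x \<in> carrier_vec n}"

definition lower_envelope :: "nat \<Rightarrow> real mat list \<Rightarrow> real mat \<Rightarrow> real vec \<Rightarrow> ereal" where
  "lower_envelope n A B a =
     Inf {ereal (quad_form B x) | x. x \<in> carrier_vec n \<and> quad_map A x = a}"

text \<open>
  The library's \<open>convex\<close> and \<open>convex_on\<close>, transcribed to carrier-based vectors because these do
  not form an instance of \<open>real_vector\<close>. For extended-real-valued functions, the convention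
  \<open>0 * \<infinity> = 0\<close> of \<open>ereal\<close> makes the inequality trivial for \<open>u = 0\<close> and for \<open>v = 0\<close>; the
  functions considered here never take the value \<open>-\<infinity>\<close>.
\<close>

definition convex_vec_set :: "real vec set \<Rightarrow> bool" where
  "convex_vec_set S \<longleftrightarrow>
     (\<forall>x\<in>S. \<forall>y\<in>S. \<forall>u\<ge>0. \<forall>v\<ge>0. u + v = 1 \<longrightarrow> u \<cdot>\<^sub>v x + v \<cdot>\<^sub>v y \<in> S)"

definition convex_vec_fun :: "nat \<Rightarrow> (real vec \<Rightarrow> ereal) \<Rightarrow> bool" where
  "convex_vec_fun m f \<longleftrightarrow>
     (\<forall>x\<in>carrier_vec m. \<forall>y\<in>carrier_vec m. \<forall>u\<ge>0. \<forall>v\<ge>0. u + v = 1 \<longrightarrow>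
        f (u \<cdot>\<^sub>v x + v \<cdot>\<^sub>v y) \<le> ereal u * f x + ereal v * f y)"

end

theory Submission
  imports Defs
begin

text \<open>
  Both implications are formal: \<open>W(A)\<close> is the effective domain of the envelope, and the
  upward closure of \<open>W(A, B)\<close> lies between its strict and its non-strict epigraph.

  If \<open>A\<close> is the map \<open>z \<mapsto> z\<^sup>2\<close> on \<open>\<complex>\<close> and \<open>B\<close> is \<open>|z|\<^sup>2\<close>, then the envelope is the Euclidean
  norm, whereas \<open>W(A, B)\<close> is only the boundary of its epigraph.

  If \<open>A\<close> is the Hopf map \<open>(z, w) \<mapsto> (|z|\<^sup>2 - |w|\<^sup>2, z * cnj w)\<close> on \<open>\<complex>\<^sup>2\<close>, then \<open>W(A)\<close> is the whole
  of \<open>\<real>\<^sup>3\<close>. The fibres are circles \<open>{(c z, c w) | |c| = 1}\<close>, and minimising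
  \<open>B = (Re z)\<^sup>2 + (Re w)\<^sup>2\<close> on them breaks the convexity: the envelope is at least \<open>3/5\<close> at
  \<open>(0, 0, 3/5)\<close>, but at most \<open>9/25\<close> at \<open>(0, 4/5, 3/5)\<close> and \<open>(0, -4/5, 3/5)\<close>.
\<close>

section \<open>The two implications\<close>

lemma dim_quad_map [simp]: "dim_vec (quad_map A x) = length A"
  by (simp add: quad_map_def)

lemma quad_map_carrier [simp]: "quad_map A x \<in> carrier_vec (length A)"
  by (simp add: carrier_vecI)

lemma index_quad_map [simp]: "i < length A \<Longrightarrow> quad_map A x $ i = quad_form (A ! i) x"
  by (simp add: quad_map_def vec_of_list_index)

lemma quad_map_in_range:
  "x \<in> carrier_vec n \<Longrightarrow> quad_map A x \<in> joint_numerical_range n A"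
  by (auto simp: joint_numerical_range_def)

text \<open>Separates the last coordinate from the others: the same \<open>z\<close> lies over the
  combination of the constraint values and realises the combination of the
  \<open>B\<close>-values.\<close>

lemma combination_quad_map_snoc:
  assumes "u \<cdot>\<^sub>v quad_map (A @ [B]) x + v \<cdot>\<^sub>v quad_map (A @ [B]) y = quad_map (A @ [B]) z"
  shows "u \<cdot>\<^sub>v quad_map A x + v \<cdot>\<^sub>v quad_map A y = quad_map A z"
    and "u * quad_form B x + v * quad_form B y = quad_form B z"
proof -
  have eq: "u * quad_form ((A @ [B]) ! i) x + v * quad_form ((A @ [B]) ! i) y
      = quad_form ((A @ [B]) ! i) z" if "i < Suc (length A)" for i
    using arg_cong[OF assms, of "\<lambda>w. w $ i"] that by simp
  show "u \<cdot>\<^sub>v quad_map A x + v \<cdot>\<^sub>v quad_map A y = quad_map A z"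
  proof (rule eq_vecI)
    fix i assume "i < dim_vec (quad_map A z)"
    then show "(u \<cdot>\<^sub>v quad_map A x + v \<cdot>\<^sub>v quad_map A y) $ i = quad_map A z $ i"
      using eq[of i] by (simp add: nth_append)
  qed simp
  show "u * quad_form B x + v * quad_form B y = quad_form B z"
    using eq[of "length A"] by simp
qed

lemma lower_envelope_le:
  "x \<in> carrier_vec n \<Longrightarrow> lower_envelope n A B (quad_map A x) \<le> ereal (quad_form B x)"
  unfolding lower_envelope_def by (rule Inf_lower) auto

text \<open>A strict upper bound has a witness even if the infimum is not attained: \<open>c\<close>
  slightly above the value gives a near-minimiser, and \<open>c = \<infinity>\<close> says that the
  fibre is nonempty.\<close>

lemma lower_envelope_lessE:
  assumes "lower_envelope n A B a < c"
  obtains x where "x \<in> carrier_vec n" "quad_map A x = a" "ereal (quad_form B x) < c"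
  using assms unfolding lower_envelope_def Inf_less_iff by auto

text \<open>Excludes the value \<open>-\<infinity>\<close>, so no sum of opposite infinities arises
  in the convexity inequality.\<close>

lemma lower_envelope_nonneg:
  assumes "B \<in> psd_mats n"
  shows "0 \<le> lower_envelope n A B a"
  unfolding lower_envelope_def using assms
  by (intro Inf_greatest) (auto simp: psd_mats_def quad_form_def)

lemma convex_lower_envelope:
  assumes B: "B \<in> psd_mats n"
    and W: "convex_vec_set (joint_numerical_range n (A @ [B]))"
  shows "convex_vec_fun (length A) (lower_envelope n A B)"
  unfolding convex_vec_fun_def
proof (intro ballI allI impI)
  fix a b :: "real vec" and u v :: real
  assume a: "a \<in> carrier_vec (length A)" and b: "b \<in> carrier_vec (length A)"
    and u: "0 \<le> u" and v: "0 \<le> v" and uv: "u + v = 1"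
  let ?V = "lower_envelope n A B"
  note nonneg = lower_envelope_nonneg[OF B, of A]
  show "?V (u \<cdot>\<^sub>v a + v \<cdot>\<^sub>v b) \<le> ereal u * ?V a + ereal v * ?V b"
  proof (cases "u = 0 \<or> v = 0")
    case True
    \<comment> \<open>A zero weight is treated apart: since \<open>0 * \<infinity> = 0\<close>, it
      hides an infinite value, and the inequality collapses to an equality at one endpoint.\<close>
    have "0 \<cdot>\<^sub>v a + 1 \<cdot>\<^sub>v b = b" "1 \<cdot>\<^sub>v a + 0 \<cdot>\<^sub>v b = a"
      using a b by auto
    with True uv show ?thesis
      by (auto simp flip: one_ereal_def zero_ereal_def)
  next
    case False
    with u v have pos: "0 < u" "0 < v" by auto
    show ?thesis
    proof (cases "?V a = \<infinity> \<or> ?V b = \<infinity>")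
      case True
      then have "ereal u * ?V a + ereal v * ?V b = \<infinity>"
        using pos nonneg by auto
      then show ?thesis by (simp only: ereal_less_eq)
    next
      case False
      with nonneg[of a] nonneg[of b] obtain p q where p: "?V a = ereal p" and q: "?V b = ereal q"
        by (cases "?V a"; cases "?V b") auto
      show ?thesis
      proof (rule ereal_le_epsilon2)
        \<comment> \<open>The infima need not be attained, so \<open>x\<close> and \<open>y\<close>
          are only \<open>e\<close>-close to optimal; the weights sum to 1, so the total error is
          again \<open>e\<close>.\<close>
        fix e :: real assume e: "0 < e"
        obtain x where x: "x \<in> carrier_vec n" "quad_map A x = a" "quad_form B x < p + e"
          using lower_envelope_lessE[of n A B a "ereal (p + e)"] e p by auto
        obtain y where y: "y \<in> carrier_vec n" "quad_map A y = b" "quad_form B y < q + e"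
          using lower_envelope_lessE[of n A B b "ereal (q + e)"] e q by auto
        have "u \<cdot>\<^sub>v quad_map (A @ [B]) x + v \<cdot>\<^sub>v quad_map (A @ [B]) y
            \<in> joint_numerical_range n (A @ [B])"
          using W quad_map_in_range[OF x(1)] quad_map_in_range[OF y(1)] u v uv
          unfolding convex_vec_set_def by blast
        then obtain z where z: "z \<in> carrier_vec n"
          and eq: "u \<cdot>\<^sub>v quad_map (A @ [B]) x + v \<cdot>\<^sub>v quad_map (A @ [B]) y = quad_map (A @ [B]) z"
          unfolding joint_numerical_range_def by blast
        have "?V (u \<cdot>\<^sub>v a + v \<cdot>\<^sub>v b) \<le> ereal (u * quad_form B x + v * quad_form B y)"
          using lower_envelope_le[OF z, of A B] combination_quad_map_snoc[OF eq] x(2) y(2) by simp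
        also have "u * quad_form B x + v * quad_form B y \<le> u * (p + e) + v * (q + e)"
          using x(3) y(3) u v by (intro add_mono mult_left_mono) auto
        also have "\<dots> = u * p + v * q + (u + v) * e"
          by (simp add: algebra_simps)
        finally show "?V (u \<cdot>\<^sub>v a + v \<cdot>\<^sub>v b) \<le> ereal u * ?V a + ereal v * ?V b + ereal e"
          using p q uv by simp
      qed
    qed
  qed
qed

lemma convex_joint_numerical_range:
  assumes V: "convex_vec_fun (length A) (lower_envelope n A B)"
  shows "convex_vec_set (joint_numerical_range n A)"
  unfolding convex_vec_set_def
proof (intro ballI allI impI)
  fix a b :: "real vec" and u v :: real
  assume "a \<in> joint_numerical_range n A" "b \<in> joint_numerical_range n A"
    and uv: "0 \<le> u" "0 \<le> v" "u + v = 1"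
  then obtain x y where x: "x \<in> carrier_vec n" "a = quad_map A x"
    and y: "y \<in> carrier_vec n" "b = quad_map A y"
    unfolding joint_numerical_range_def by blast
  let ?V = "lower_envelope n A B"
  have "?V (u \<cdot>\<^sub>v a + v \<cdot>\<^sub>v b) \<le> ereal u * ?V a + ereal v * ?V b"
    using V x y uv unfolding convex_vec_fun_def by simp
  also have "\<dots> \<le> ereal u * ereal (quad_form B x) + ereal v * ereal (quad_form B y)"
    using lower_envelope_le x y uv by (intro add_mono ereal_mult_left_mono) auto
  \<comment> \<open>Only finiteness of the bound matters: it forces the fibre over the combination
    to be nonempty.\<close>
  also have "\<dots> < \<infinity>" by simp
  finally obtain z where "z \<in> carrier_vec n" "quad_map A z = u \<cdot>\<^sub>v a + v \<cdot>\<^sub>v b"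
    by (rule lower_envelope_lessE)
  then show "u \<cdot>\<^sub>v a + v \<cdot>\<^sub>v b \<in> joint_numerical_range n A"
    by (metis quad_map_in_range)
qed

section \<open>Forms with explicit coefficients\<close>

lemma quad_form_mat_of_rows_list:
  assumes "length rs = n" "x \<in> carrier_vec n"
  shows "quad_form (mat_of_rows_list n rs) x = (\<Sum>i<n. \<Sum>j<n. rs ! i ! j * x $ i * x $ j)"
  using assms unfolding quad_form_def mat_of_rows_list_def
  by (auto simp: scalar_prod_def sum_distrib_left atLeast0LessThan mult_ac intro!: sum.cong)

lemma mat_of_rows_list_sym_mats:
  assumes "length rs = n" "\<And>i j. i < n \<Longrightarrow> j < i \<Longrightarrow> rs ! i ! j = rs ! j ! i"
  shows "mat_of_rows_list n rs \<in> sym_mats n"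
proof -
  have "rs ! i ! j = rs ! j ! i" if "i < n" "j < n" for i j
    using assms(2)[of i j] assms(2)[of j i] that by (cases i j rule: linorder_cases) auto
  then show ?thesis
    using assms(1) by (auto simp: sym_mats_def mat_of_rows_list_def)
qed

text \<open>A complex square root \<open>s + i t\<close> of \<open>a + i b\<close>, in real
  coordinates. It supplies preimages for both examples.\<close>

lemma exists_square_components: "\<exists>s t :: real. s\<^sup>2 - t\<^sup>2 = a \<and> 2 * s * t = b"
proof -
  have eq: "(csqrt (Complex a b))\<^sup>2 = Complex a b" by simp
  show ?thesis
    using arg_cong[OF eq, of Re] arg_cong[OF eq, of Im] unfolding Re_power2 Im_power2 by auto
qed

section \<open>A convex envelope over a non-convex range\<close>

definition square_forms :: "real mat list" where
  "square_forms = [mat_of_rows_list 2 [[1, 0], [0, -1]], mat_of_rows_list 2 [[0, 1], [1, 0]]]"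

definition modulus_form :: "real mat" where
  "modulus_form = mat_of_rows_list 2 [[1, 0], [0, 1]]"

lemma square_forms_sym: "set square_forms \<subseteq> sym_mats 2"
  unfolding square_forms_def
  by (auto intro!: mat_of_rows_list_sym_mats simp: less_Suc_eq numeral_2_eq_2)

lemma quad_map_square_forms:
  assumes "x \<in> carrier_vec 2"
  shows "quad_map square_forms x = vec_of_list [(x $ 0)\<^sup>2 - (x $ 1)\<^sup>2, 2 * x $ 0 * x $ 1]"
  using assms
  by (simp add: quad_map_def square_forms_def quad_form_mat_of_rows_list lessThan_nat_numeral
      lessThan_Suc power2_eq_square numeral_2_eq_2)

lemma quad_form_modulus_form:
  assumes "x \<in> carrier_vec 2"
  shows "quad_form modulus_form x = (x $ 0)\<^sup>2 + (x $ 1)\<^sup>2"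
  using assms
  by (simp add: modulus_form_def quad_form_mat_of_rows_list lessThan_Suc power2_eq_square
      numeral_2_eq_2)

lemma modulus_form_psd: "modulus_form \<in> psd_mats 2"
proof -
  have "modulus_form \<in> sym_mats 2"
    unfolding modulus_form_def
    by (auto intro!: mat_of_rows_list_sym_mats simp: less_Suc_eq numeral_2_eq_2)
  then show ?thesis
    using quad_form_modulus_form by (simp add: psd_mats_def quad_form_def)
qed

text \<open>Since |z|^2 = |z^2|, the form is constant on each fibre, so the infimum is taken over a
  single value; a square root of \<open>a\<close> shows that the fibre is nonempty.\<close>

lemma lower_envelope_square_forms:
  assumes "a \<in> carrier_vec 2"
  shows "lower_envelope 2 square_forms modulus_form a = ereal (cmod (Complex (a $ 0) (a $ 1)))"
proof -
  have norm: "quad_form modulus_form x = cmod (Complex (a $ 0) (a $ 1))"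
    if x: "x \<in> carrier_vec 2" and "quad_map square_forms x = a" for x
  proof -
    have "a $ 0 = (x $ 0)\<^sup>2 - (x $ 1)\<^sup>2" "a $ 1 = 2 * x $ 0 * x $ 1"
      using quad_map_square_forms[OF x] that(2) by auto
    then have "Complex (a $ 0) (a $ 1) = (Complex (x $ 0) (x $ 1))\<^sup>2"
      by (simp add: complex_eq_iff Re_power2 Im_power2)
    then show ?thesis
      by (simp add: norm_power cmod_power2 quad_form_modulus_form[OF x])
  qed
  obtain s t where st: "s\<^sup>2 - t\<^sup>2 = a $ 0" "2 * s * t = a $ 1"
    using exists_square_components by blast
  let ?x = "vec_of_list [s, t]"
  have x: "?x \<in> carrier_vec 2" by (intro carrier_vecI) simp
  have "quad_map square_forms ?x = vec_of_list [a $ 0, a $ 1]"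
    using quad_map_square_forms[OF x] st by simp
  also have "\<dots> = a"
    using assms by (intro eq_vecI) (auto simp: less_Suc_eq numeral_2_eq_2)
  finally have qx: "quad_map square_forms ?x = a" .
  show ?thesis
  proof (rule antisym)
    show "lower_envelope 2 square_forms modulus_form a \<le> ereal (cmod (Complex (a $ 0) (a $ 1)))"
      using lower_envelope_le[OF x, of square_forms modulus_form] norm[OF x qx]
      unfolding qx by simp
    show "ereal (cmod (Complex (a $ 0) (a $ 1))) \<le> lower_envelope 2 square_forms modulus_form a"
      unfolding lower_envelope_def using norm by (intro Inf_greatest) auto
  qed
qed

text \<open>The envelope is the modulus on the complex plane, so this is the triangle
  inequality.\<close>

lemma convex_lower_envelope_square_forms:
  "convex_vec_fun 2 (lower_envelope 2 square_forms modulus_form)"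
  unfolding convex_vec_fun_def
proof (intro ballI allI impI)
  fix a b :: "real vec" and u v :: real
  assume a: "a \<in> carrier_vec 2" and b: "b \<in> carrier_vec 2" and uv: "0 \<le> u" "0 \<le> v"
  let ?z = "\<lambda>a. Complex (a $ 0) (a $ 1)"
  have "?z (u \<cdot>\<^sub>v a + v \<cdot>\<^sub>v b) = of_real u * ?z a + of_real v * ?z b"
    using a b by (simp add: complex_eq_iff)
  then have "cmod (?z (u \<cdot>\<^sub>v a + v \<cdot>\<^sub>v b)) \<le> u * cmod (?z a) + v * cmod (?z b)"
    using uv norm_triangle_ineq[of "of_real u * ?z a" "of_real v * ?z b"] by (simp add: norm_mult)
  moreover have "u \<cdot>\<^sub>v a + v \<cdot>\<^sub>v b \<in> carrier_vec 2"
    using a b by simp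
  ultimately show "lower_envelope 2 square_forms modulus_form (u \<cdot>\<^sub>v a + v \<cdot>\<^sub>v b)
      \<le> ereal u * lower_envelope 2 square_forms modulus_form a
        + ereal v * lower_envelope 2 square_forms modulus_form b"
    using a b by (simp add: lower_envelope_square_forms)
qed

lemma not_convex_range_square_forms:
  "\<not> convex_vec_set (joint_numerical_range 2 (square_forms @ [modulus_form]))"
proof
  assume W: "convex_vec_set (joint_numerical_range 2 (square_forms @ [modulus_form]))"
  let ?q = "quad_map (square_forms @ [modulus_form])"
  \<comment> \<open>These are z = 1 and z = i, with squares 1 and -1 and modulus 1. Their images
    have midpoint (0, 0, 1), whose preimage would need z^2 = 0 and |z|^2 = 1.\<close>
  let ?e = "vec_of_list [1, 0] :: real vec" and ?f = "vec_of_list [0, 1] :: real vec"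
  have e: "?e \<in> carrier_vec 2" and f: "?f \<in> carrier_vec 2"
    by (auto intro!: carrier_vecI)
  have "(1/2) \<cdot>\<^sub>v ?q ?e + (1/2) \<cdot>\<^sub>v ?q ?f \<in> joint_numerical_range 2 (square_forms @ [modulus_form])"
    using W quad_map_in_range[OF e] quad_map_in_range[OF f] unfolding convex_vec_set_def by simp
  then obtain z where z: "z \<in> carrier_vec 2"
    and eq: "(1/2) \<cdot>\<^sub>v ?q ?e + (1/2) \<cdot>\<^sub>v ?q ?f = ?q z"
    unfolding joint_numerical_range_def by blast
  note * = combination_quad_map_snoc[OF eq]
  have "(z $ 0)\<^sup>2 - (z $ 1)\<^sup>2 = 0" "2 * z $ 0 * z $ 1 = 0"
    using arg_cong[OF *(1), of "\<lambda>w. w $ 0"] arg_cong[OF *(1), of "\<lambda>w. w $ 1"] e f z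
    by (auto simp: quad_map_square_forms)
  moreover have "(z $ 0)\<^sup>2 + (z $ 1)\<^sup>2 = 1"
    using *(2) e f z by (simp add: quad_form_modulus_form)
  ultimately show False by auto
qed

section \<open>A non-convex envelope over a convex range\<close>

text \<open>The coordinates of a vector \<open>x\<close> are those of \<open>z = x\<^sub>0 + i x\<^sub>1\<close> and \<open>w = x\<^sub>2 + i x\<^sub>3\<close>.\<close>

definition hopf_forms :: "real mat list" where
  "hopf_forms =
    [mat_of_rows_list 4 [[1, 0, 0, 0], [0, 1, 0, 0], [0, 0, -1, 0], [0, 0, 0, -1]],
     mat_of_rows_list 4 [[0, 0, 1/2, 0], [0, 0, 0, 1/2], [1/2, 0, 0, 0], [0, 1/2, 0, 0]],
     mat_of_rows_list 4 [[0, 0, 0, -1/2], [0, 0, 1/2, 0], [0, 1/2, 0, 0], [-1/2, 0, 0, 0]]]"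

definition real_part_form :: "real mat" where
  "real_part_form =
    mat_of_rows_list 4 [[1, 0, 0, 0], [0, 0, 0, 0], [0, 0, 1, 0], [0, 0, 0, 0]]"

lemma hopf_forms_sym: "set hopf_forms \<subseteq> sym_mats 4"
  unfolding hopf_forms_def
  by (auto intro!: mat_of_rows_list_sym_mats simp: less_Suc_eq eval_nat_numeral)

lemma quad_map_hopf_forms:
  assumes "x \<in> carrier_vec 4"
  shows "quad_map hopf_forms x =
    vec_of_list [(x $ 0)\<^sup>2 + (x $ 1)\<^sup>2 - (x $ 2)\<^sup>2 - (x $ 3)\<^sup>2,
      x $ 0 * x $ 2 + x $ 1 * x $ 3, x $ 1 * x $ 2 - x $ 0 * x $ 3]"
  using assms
  by (simp add: quad_map_def hopf_forms_def quad_form_mat_of_rows_list lessThan_Suc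
      eval_nat_numeral mult_ac)

lemma quad_form_real_part_form:
  assumes "x \<in> carrier_vec 4"
  shows "quad_form real_part_form x = (x $ 0)\<^sup>2 + (x $ 2)\<^sup>2"
  using assms
  by (simp add: real_part_form_def quad_form_mat_of_rows_list lessThan_Suc eval_nat_numeral)

lemma real_part_form_psd: "real_part_form \<in> psd_mats 4"
proof -
  have "real_part_form \<in> sym_mats 4"
    unfolding real_part_form_def
    by (auto intro!: mat_of_rows_list_sym_mats simp: less_Suc_eq eval_nat_numeral)
  then show ?thesis
    using quad_form_real_part_form by (simp add: psd_mats_def quad_form_def)
qed

lemma joint_numerical_range_hopf_forms: "joint_numerical_range 4 hopf_forms = carrier_vec 3"
proof (intro subset_antisym subsetI)
  fix a :: "real vec" assume a: "a \<in> carrier_vec 3"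
  define r where "r = cmod (Complex (a $ 1) (a $ 2))"
  obtain \<theta> where \<theta>: "Complex (a $ 1) (a $ 2) = of_real r * cis \<theta>"
    using rcis_cmod_Arg[of "Complex (a $ 1) (a $ 2)"] unfolding r_def rcis_def by metis
  \<comment> \<open>Take z = s real and w = t * \<open>cis (- \<theta>)\<close>. Then z * cnj w = s
    * t * \<open>cis \<theta>\<close>, so the conditions are s^2 - t^2 = \<open>a $ 0\<close> and s
    * t = \<open>r\<close>, solved by a square root of \<open>a $ 0\<close> + 2 * \<open>r\<close> *
    i.\<close>
  obtain s t where st: "s\<^sup>2 - t\<^sup>2 = a $ 0" "2 * s * t = 2 * r"
    using exists_square_components by blast
  have a12: "a $ 1 = r * cos \<theta>" "a $ 2 = r * sin \<theta>"
    using arg_cong[OF \<theta>, of Re] arg_cong[OF \<theta>, of Im] by auto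
  have t: "(t * cos \<theta>)\<^sup>2 + (t * sin \<theta>)\<^sup>2 = t\<^sup>2"
    by (simp add: power_mult_distrib flip: distrib_left)
  let ?x = "vec_of_list [s, 0, t * cos \<theta>, - (t * sin \<theta>)]"
  have x: "?x \<in> carrier_vec 4" by (intro carrier_vecI) simp
  have "quad_map hopf_forms ?x = vec_of_list [a $ 0, a $ 1, a $ 2]"
    using quad_map_hopf_forms[OF x] st t a12 by (simp add: eval_nat_numeral)
  also have "\<dots> = a"
    using a by (intro eq_vecI) (auto simp: less_Suc_eq eval_nat_numeral)
  finally show "a \<in> joint_numerical_range 4 hopf_forms"
    using quad_map_in_range[OF x, of hopf_forms] by simp
next
  fix a assume "a \<in> joint_numerical_range 4 hopf_forms"
  moreover have "length hopf_forms = 3" by (simp add: hopf_forms_def)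
  ultimately show "a \<in> carrier_vec 3"
    using quad_map_carrier[of hopf_forms] by (auto simp: joint_numerical_range_def)
qed

lemma not_convex_lower_envelope_hopf_forms:
  "\<not> convex_vec_fun 3 (lower_envelope 4 hopf_forms real_part_form)"
proof
  let ?V = "lower_envelope 4 hopf_forms real_part_form"
  assume V: "convex_vec_fun 3 ?V"
  have le: "?V (vec_of_list [0, c, 3/5]) \<le> ereal (9/25)" if "c\<^sup>2 = 16/25" for c
  proof -
    \<comment> \<open>Here z = i and w = 3/5 + i c lie on the unit circle, with z * cnj w = c + 3/5
      * i. The phase is chosen so that Re z = 0, leaving only (Re w)^2 = 9/25.\<close>
    let ?x = "vec_of_list [0, 1, 3/5, c]"
    have x: "?x \<in> carrier_vec 4" by (intro carrier_vecI) simp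
    have "quad_map hopf_forms ?x = vec_of_list [0, c, 3/5]"
      using quad_map_hopf_forms[OF x] that
      by (simp add: numeral_2_eq_2 numeral_3_eq_3 field_simps)
    moreover have "quad_form real_part_form ?x = 9/25"
      using quad_form_real_part_form[OF x] by (simp add: numeral_2_eq_2)
    ultimately show ?thesis
      using lower_envelope_le[OF x, of hopf_forms real_part_form] by (simp only:)
  qed
  let ?a = "vec_of_list [0, 4/5, 3/5] :: real vec"
    and ?b = "vec_of_list [0, - (4/5), 3/5] :: real vec"
    and ?m = "vec_of_list [0, 0, 3/5] :: real vec"
  have "?V ((1/2) \<cdot>\<^sub>v ?a + (1/2) \<cdot>\<^sub>v ?b) \<le> ereal (1/2) * ?V ?a + ereal (1/2) * ?V ?b"
  proof -
    have "?a \<in> carrier_vec 3" "?b \<in> carrier_vec 3"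
      by (auto intro!: carrier_vecI)
    then show ?thesis
      using V unfolding convex_vec_fun_def by simp
  qed
  also have "(1/2) \<cdot>\<^sub>v ?a + (1/2) \<cdot>\<^sub>v ?b = ?m"
    by (intro eq_vecI) (auto simp: less_Suc_eq eval_nat_numeral)
  also have "ereal (1/2) * ?V ?a + ereal (1/2) * ?V ?b
      \<le> ereal (1/2) * ereal (9/25) + ereal (1/2) * ereal (9/25)"
    by (intro add_mono ereal_mult_left_mono le) (auto simp: power2_eq_square)
  also have "\<dots> < ereal (3/5)" by simp
  finally obtain x where x: "x \<in> carrier_vec 4" and "quad_map hopf_forms x = ?m"
    and less: "quad_form real_part_form x < 3/5"
    by (auto elim: lower_envelope_lessE)
  then have eq: "vec_of_list [(x $ 0)\<^sup>2 + (x $ 1)\<^sup>2 - (x $ 2)\<^sup>2 - (x $ 3)\<^sup>2,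
      x $ 0 * x $ 2 + x $ 1 * x $ 3, x $ 1 * x $ 2 - x $ 0 * x $ 3] = ?m"
    using quad_map_hopf_forms by simp
  define p q r s where "p = x $ 0" and "q = x $ 1" and "r = x $ 2" and "s = x $ 3"
  have h: "p\<^sup>2 + q\<^sup>2 - r\<^sup>2 - s\<^sup>2 = 0" "p * r + q * s = 0" "q * r - p * s = 3/5"
    using arg_cong[OF eq, of "\<lambda>w. w $ 0"] arg_cong[OF eq, of "\<lambda>w. w $ 1"]
      arg_cong[OF eq, of "\<lambda>w. w $ 2"]
    by (auto simp: p_def q_def r_def s_def eval_nat_numeral)
  define \<rho> where "\<rho> = p\<^sup>2 + q\<^sup>2"
  have \<rho>: "\<rho> = r\<^sup>2 + s\<^sup>2" "0 \<le> \<rho>"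
    using h(1) by (simp_all add: \<rho>_def)
  \<comment> \<open>The identity |z|^2 * |w|^2 = |z * cnj w|^2, combined with |z| = |w|, determines
    \<open>\<rho>\<close>.\<close>
  have "\<rho>\<^sup>2 = (p\<^sup>2 + q\<^sup>2) * (r\<^sup>2 + s\<^sup>2)"
    using \<rho>(1) by (simp add: \<rho>_def power2_eq_square)
  also have "\<dots> = (p * r + q * s)\<^sup>2 + (q * r - p * s)\<^sup>2"
    by (simp add: power2_eq_square algebra_simps)
  also have "\<dots> = (3/5)\<^sup>2"
    by (simp add: h)
  finally have "\<rho> = 3/5"
    using \<rho>(2) by (simp add: power2_eq_iff_nonneg)
  \<comment> \<open>\<open>|z|\<^sup>2 = |w|\<^sup>2 = 3/5\<close> and \<open>z * cnj w = 3/5 * i\<close> force \<open>w = - i z\<close>, so \<open>(Re w)\<^sup>2 = (Im z)\<^sup>2\<close>.\<close>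
  have "(q - r)\<^sup>2 + (p + s)\<^sup>2 = (p\<^sup>2 + q\<^sup>2) + (r\<^sup>2 + s\<^sup>2) - 2 * (q * r - p * s)"
    by (simp add: power2_eq_square algebra_simps)
  also have "\<dots> = 0"
    using \<open>\<rho> = 3/5\<close> \<rho>(1) h(3) by (simp add: \<rho>_def)
  finally have "q = r"
    by (simp add: sum_power2_eq_zero_iff)
  then have "p\<^sup>2 + r\<^sup>2 = 3/5"
    using \<open>\<rho> = 3/5\<close> by (simp add: \<rho>_def)
  with less quad_form_real_part_form[OF x] show False
    by (simp add: p_def r_def)
qed

theorem proposition3p1:
  shows "(\<forall>m n A B. length A = m \<and> set A \<subseteq> sym_mats n \<and> B \<in> psd_mats n \<longrightarrow>
           (convex_vec_set (joint_numerical_range n (A @ [B])) \<longrightarrow>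
              convex_vec_fun m (lower_envelope n A B)) \<and>
           (convex_vec_fun m (lower_envelope n A B) \<longrightarrow>
              convex_vec_set (joint_numerical_range n A)))
       \<and> (\<exists>m n A B. 0 < m \<and> 0 < n \<and> length A = m \<and> set A \<subseteq> sym_mats n \<and> B \<in> psd_mats n \<and>
           convex_vec_fun m (lower_envelope n A B) \<and>
           \<not> convex_vec_set (joint_numerical_range n (A @ [B])))
       \<and> (\<exists>m n A B. 0 < m \<and> 0 < n \<and> length A = m \<and> set A \<subseteq> sym_mats n \<and> B \<in> psd_mats n \<and>
           convex_vec_set (joint_numerical_range n A) \<and>
           \<not> convex_vec_fun m (lower_envelope n A B))"
proof (intro conjI)
  show "\<forall>m n A B. length A = m \<and> set A \<subseteq> sym_mats n \<and> B \<in> psd_mats n \<longrightarrow>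
           (convex_vec_set (joint_numerical_range n (A @ [B])) \<longrightarrow>
              convex_vec_fun m (lower_envelope n A B)) \<and>
           (convex_vec_fun m (lower_envelope n A B) \<longrightarrow>
              convex_vec_set (joint_numerical_range n A))"
    using convex_lower_envelope convex_joint_numerical_range by blast
  have "length square_forms = 2" by (simp add: square_forms_def)
  then show "\<exists>m n A B. 0 < m \<and> 0 < n \<and> length A = m \<and> set A \<subseteq> sym_mats n \<and> B \<in> psd_mats n \<and>
           convex_vec_fun m (lower_envelope n A B) \<and>
           \<not> convex_vec_set (joint_numerical_range n (A @ [B]))"
    using square_forms_sym modulus_form_psd convex_lower_envelope_square_forms
      not_convex_range_square_forms
    by (intro exI[of _ 2] exI[of _ square_forms] exI[of _ modulus_form]) simp
  have "length hopf_forms = 3" by (simp add: hopf_forms_def)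
  moreover have "convex_vec_set (joint_numerical_range 4 hopf_forms)"
    by (simp add: convex_vec_set_def joint_numerical_range_hopf_forms)
  ultimately show "\<exists>m n A B. 0 < m \<and> 0 < n \<and> length A = m \<and> set A \<subseteq> sym_mats n \<and> B \<in> psd_mats n \<and>
           convex_vec_set (joint_numerical_range n A) \<and>
           \<not> convex_vec_fun m (lower_envelope n A B)"
    using hopf_forms_sym real_part_form_psd not_convex_lower_envelope_hopf_forms
    by (intro exI[of _ 3] exI[of _ 4] exI[of _ hopf_forms] exI[of _ real_part_form]) simp
qed

end
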